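(* Let $n\ge4$ and let $P$ be the matroid polytope of the uniform matroid $U_{2,n}$, with $h^*$-vector $(h_0^*,h_1^*,\dots)$. Let $P_{1,n-1}$ be the set of permutations of $[n-1]$ with exactly one descent. Then $$h_0^*+h_1^*=\#\{\pi\in P_{1,n-1}: ig(\pi)=0\},\qquad h_k^*=\#\{\pi\in P_{1,n-1}: ig(\pi)=k-1\}\ \text{ for all }k\ge2.$$
   Context: $U_{2,n}$ is the matroid on $[n]$ whose bases are all $2$-subsets; its matroid polytope is $\mathrm{conv}\{e_i+e_j:1\le i<j\le n\}$. For a lattice polytope $P$ of dimension $d$, the $h^*$-vector is defined by $\sum_{t\ge0}\#(tP\cap\mathbb{Z}^n)z^t=\frac{\sum_i h_i^*z^i}{(1-z)^{d+1}}$. For $\pi=\pi_1\cdots\pi_{n-1}\in P_{1,n-1}$ (one-line notation) let $d(\pi)$ be the position of its unique descent ($\pi_{d(\pi)}>\pi_{d(\pi)+1}$). The number of initial gaps is $ig(\pi)=\#\{i:1\le i<d(\pi),\ \pi_{i+1}\ne\pi_i+1\}$. *)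

theory Defs
  imports
    "HOL-Analysis.Analysis"
    "HOL-Computational_Algebra.Formal_Power_Series"
    "HOL-Combinatorics.Permutations"
begin

text \<open>
  The ground set \<open>[n]\<close> is the index type \<open>'n\<close> with \<open>n = CARD('n)\<close>; a matroid on it is
  given by its set of bases.
\<close>

definition uniform_matroid_bases :: "nat \<Rightarrow> 'n::finite set set" where
  "uniform_matroid_bases k = {B. card B = k}"

definition matroid_polytope :: "'n::finite set set \<Rightarrow> (real ^ 'n) set" where
  "matroid_polytope \<B> = convex hull ((\<lambda>B. \<Sum>i\<in>B. axis i 1) ` \<B>)"

lemma matroid_polytope_uniform_2:
  "matroid_polytope (uniform_matroid_bases 2) =
     convex hull {axis i 1 + axis j 1 | i j :: 'n::finite. i \<noteq> j}"
proof -
  have "(\<lambda>B. \<Sum>i\<in>B. axis i (1::real)) ` {B :: 'n set. card B = 2} =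
          {axis i 1 + axis j 1 | i j :: 'n. i \<noteq> j}" (is "?f ` _ = ?R")
  proof (intro equalityI subsetI)
    fix x assume "x \<in> ?f ` {B. card B = 2}"
    then obtain B :: "'n set" where B: "card B = 2" "x = ?f B" by auto
    then obtain i j where "B = {i, j}" "i \<noteq> j" by (auto simp: card_2_iff)
    with B have "x = axis i 1 + axis j 1 \<and> i \<noteq> j" by simp
    then show "x \<in> ?R" by blast
  next
    fix x assume "x \<in> ?R"
    then obtain i j :: 'n where "i \<noteq> j" "x = axis i 1 + axis j 1" by auto
    then show "x \<in> ?f ` {B. card B = 2}" by (intro image_eqI[of _ _ "{i, j}"]) auto
  qed
  then show ?thesis by (simp add: matroid_polytope_def uniform_matroid_bases_def)
qed

definition lattice_point_count :: "(real ^ 'n::finite) set \<Rightarrow> nat \<Rightarrow> nat" where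
  "lattice_point_count P t = card {x \<in> (*\<^sub>R) (real t) ` P. \<forall>i. x $ i \<in> \<int>}"

definition ehrhart_series :: "(real ^ 'n::finite) set \<Rightarrow> int fps" where
  "ehrhart_series P = Abs_fps (\<lambda>t. int (lattice_point_count P t))"

text \<open>
  The defining equation \<open>Ehr\<^sub>P(z) = (\<Sum>i. h\<^sub>i z\<^sup>i) / (1 - z)\<^bsup>d+1\<^esup>\<close>, \<open>d = dim P\<close>, solved for the
  numerator; \<open>1 - z\<close> is a unit in the ring of formal power series. Entries beyond the degree of
  the numerator are \<open>0\<close>.
\<close>

definition h_star :: "(real ^ 'n::finite) set \<Rightarrow> nat \<Rightarrow> int" where
  "h_star P k = fps_nth (ehrhart_series P * (1 - fps_X) ^ (nat (aff_dim P) + 1)) k"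

text \<open>
  Permutations of \<open>[m]\<close> are functions permuting \<open>{1..m}\<close>, with one-line notation
  \<open>\<pi> 1, \<dots>, \<pi> m\<close>.
\<close>

definition descents :: "nat \<Rightarrow> (nat \<Rightarrow> nat) \<Rightarrow> nat set" where
  "descents m \<pi> = {i. 1 \<le> i \<and> i < m \<and> \<pi> i > \<pi> (i + 1)}"

definition perms_with_descents :: "nat \<Rightarrow> nat \<Rightarrow> (nat \<Rightarrow> nat) set" where
  "perms_with_descents k m = {\<pi>. \<pi> permutes {1..m} \<and> card (descents m \<pi>) = k}"

definition descent_pos :: "nat \<Rightarrow> (nat \<Rightarrow> nat) \<Rightarrow> nat" where
  "descent_pos m \<pi> = (THE i. i \<in> descents m \<pi>)"

definition initial_gaps :: "nat \<Rightarrow> (nat \<Rightarrow> nat) \<Rightarrow> nat" where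
  "initial_gaps m \<pi> = card {i. 1 \<le> i \<and> i < descent_pos m \<pi> \<and> \<pi> (i + 1) \<noteq> \<pi> i + 1}"

end

theory Submission
  imports Defs "HOL-Computational_Algebra.Formal_Laurent_Series"
begin

text \<open>
  The lattice points of \<open>tP\<close> are the integer vectors with entries in \<open>[0, t]\<close> and sum \<open>2t\<close>; at most
  one entry of a vector with sum \<open>2t\<close> exceeds \<open>t\<close>, so with \<open>m = n - 1\<close> there are
  \<open>C(2t + m, m) - n C(t + m - 1, m)\<close> of them. Since \<open>1 / (1 - z)\<^sup>n = (1 + z)\<^sup>n / (1 - z\<^sup>2)\<^sup>n\<close>, extracting
  even coefficients gives \<open>h\<^sub>k = C(n, 2k) - n [k = 1]\<close>.
  A permutation of \<open>[m]\<close> with a single descent at \<open>d\<close> is determined by the set \<open>A\<close> of its first \<open>d\<close>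
  values, which can be any subset of \<open>[m]\<close> other than an initial segment. Its initial gaps count
  the maximal intervals of \<open>A\<close> minus one, and \<open>C(m + 1, 2k)\<close> subsets of \<open>[m]\<close> have \<open>k\<close> maximal intervals.
\<close>

section \<open>The Ehrhart series\<close>

text \<open>Stars and bars: listing the index type once, as \<open>xs\<close>, turns functions into
  lists of fixed length and sum, which \<open>card_length_sum_list\<close> counts.\<close>

lemma card_nat_functions_sum:
  "card {f::'a::finite \<Rightarrow> nat. sum f UNIV = N} = (N + CARD('a) - 1) choose N"
proof -
  obtain xs :: "'a list" where xs: "set xs = UNIV" "distinct xs"
    using finite_distinct_list[of "UNIV :: 'a set"] by auto
  have len: "length xs = CARD('a)"
    using xs distinct_card by fastforce
  have "bij_betw (\<lambda>f. map f xs) {f::'a \<Rightarrow> nat. sum f UNIV = N}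
          {l. length l = CARD('a) \<and> sum_list l = N}"
    unfolding bij_betw_def
  proof
    show "inj_on (\<lambda>f. map f xs) {f::'a \<Rightarrow> nat. sum f UNIV = N}"
      using xs by (auto simp: inj_on_def fun_eq_iff)
    show "(\<lambda>f. map f xs) ` {f. sum f UNIV = N} = {l. length l = CARD('a) \<and> sum_list l = N}"
    proof (intro equalityI subsetI)
      fix l assume "l \<in> (\<lambda>f. map f xs) ` {f. sum f UNIV = N}"
      then show "l \<in> {l. length l = CARD('a) \<and> sum_list l = N}"
        using xs len by (auto simp: sum_list_distinct_conv_sum_set)
    next
      fix l :: "nat list" assume l: "l \<in> {l. length l = CARD('a) \<and> sum_list l = N}"
      \<comment> \<open>The preimage of \<open>l\<close> sends each index to the entry of
        \<open>l\<close> at its position in \<open>xs\<close>; \<open>the\<close> is safe because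
        \<open>xs\<close> enumerates the whole type.\<close>
      define f where "f = (\<lambda>i. the (map_of (zip xs l) i))"
      have m: "map f xs = l"
        using l len xs(2) unfolding f_def
        by (intro nth_equalityI) (auto simp: map_of_zip_nth)
      have "sum f UNIV = sum_list (map f xs)"
        using xs by (simp add: sum_list_distinct_conv_sum_set)
      with m l show "l \<in> (\<lambda>f. map f xs) ` {f. sum f UNIV = N}" by (auto intro!: image_eqI[of _ _ f])
    qed
  qed
  then have "card {f::'a \<Rightarrow> nat. sum f UNIV = N} = card {l::nat list. length l = CARD('a) \<and> sum_list l = N}"
    by (rule bij_betw_same_card)
  then show ?thesis by (simp add: card_length_sum_list)
qed

lemma finite_nat_functions_sum: "finite {f::'a::finite \<Rightarrow> nat. sum f UNIV = N}"
proof (rule card_ge_0_finite)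
  have "CARD('a) > 0" by simp
  then show "card {f::'a \<Rightarrow> nat. sum f UNIV = N} > 0"
    unfolding card_nat_functions_sum by (intro zero_less_binomial) linarith
qed

text \<open>Subtracting \<open>t + 1\<close> from the large entry at \<open>i\<close> removes the
  lower bound and leaves an arbitrary function with sum \<open>t - 1\<close>.\<close>

lemma card_nat_functions_sum_gt:
  fixes i :: "'a::finite"
  assumes "CARD('a) = Suc m" "m > 0"
  shows "card {f::'a \<Rightarrow> nat. sum f UNIV = 2 * t \<and> t < f i} = (t + m - 1) choose m"
proof (cases t)
  \<comment> \<open>There is no \<open>t - 1\<close> here; both sides are 0, since
    \<open>(m - 1) choose m = 0\<close> for \<open>m > 0\<close>.\<close>
  case 0
  then have "{f::'a \<Rightarrow> nat. sum f UNIV = 2 * t \<and> t < f i} = {}" by auto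
  then have "card {f::'a \<Rightarrow> nat. sum f UNIV = 2 * t \<and> t < f i} = 0" by (simp only: card.empty)
  with 0 assms show ?thesis by simp
next
  case (Suc s)
  have upd: "sum (f(i := v)) UNIV = v + sum f (UNIV - {i})" for f :: "'a \<Rightarrow> nat" and v
    by (subst sum.remove[of _ i]) (auto intro!: sum.cong)
  have rem: "sum f UNIV = f i + sum f (UNIV - {i})" for f :: "'a \<Rightarrow> nat"
    by (subst sum.remove[of _ i]) auto
  have "bij_betw (\<lambda>g. g(i := g i + t + 1)) {g::'a \<Rightarrow> nat. sum g UNIV = s}
          {f. sum f UNIV = 2 * t \<and> t < f i}"
  proof (rule bij_betw_byWitness[where f' = "\<lambda>f. f(i := f i - (t + 1))"])
    show "(\<lambda>g. g(i := g i + t + 1)) ` {g. sum g UNIV = s} \<subseteq> {f. sum f UNIV = 2 * t \<and> t < f i}"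
      using Suc by (auto simp: upd) (simp add: rem)
    show "(\<lambda>f. f(i := f i - (t + 1))) ` {f. sum f UNIV = 2 * t \<and> t < f i} \<subseteq> {g. sum g UNIV = s}"
      using Suc by (auto simp: upd) (simp add: rem)
  qed (auto simp: fun_eq_iff)
  then have "card {f::'a \<Rightarrow> nat. sum f UNIV = 2 * t \<and> t < f i} = (s + m) choose s"
    using bij_betw_same_card card_nat_functions_sum[where 'a='a and N=s] assms by fastforce
  also have "\<dots> = (s + m) choose m"
    by (subst binomial_symmetric) auto
  finally show ?thesis using Suc by simp
qed

text \<open>Two entries above \<open>t\<close> would already exceed the sum \<open>2 * t\<close>, so
  the bad events \<open>?E i\<close> are pairwise disjoint and inclusion-exclusion stops after its
  first correction.\<close>

lemma card_bounded_nat_functions_sum: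
  assumes n: "CARD('a::finite) = Suc m" "m > 0"
  shows "int (card {f::'a \<Rightarrow> nat. (\<forall>i. f i \<le> t) \<and> sum f UNIV = 2 * t}) =
    int ((2 * t + m) choose m) - int (Suc m) * int ((t + m - 1) choose m)"
proof -
  let ?S = "{f::'a \<Rightarrow> nat. sum f UNIV = 2 * t}"
  let ?B = "{f::'a \<Rightarrow> nat. (\<forall>i. f i \<le> t) \<and> sum f UNIV = 2 * t}"
  let ?E = "\<lambda>i. {f::'a \<Rightarrow> nat. sum f UNIV = 2 * t \<and> t < f i}"
  have fin: "finite ?S" by (rule finite_nat_functions_sum)
  have finE: "finite (?E i)" for i by (rule finite_subset[OF _ fin]) blast
  have S: "?S = ?B \<union> (\<Union>i. ?E i)" by (auto simp: not_le)
  have disj: "?E i \<inter> ?E j = {}" if "i \<noteq> j" for i j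
  proof -
    { fix f :: "'a \<Rightarrow> nat" assume f: "sum f UNIV = 2 * t" "t < f i" "t < f j"
      have "sum f {i, j} \<le> sum f UNIV" by (rule sum_mono2) auto
      with f that have False by simp }
    then show ?thesis by blast
  qed
  have "card (\<Union>i. ?E i) = (\<Sum>i\<in>UNIV. card (?E i))"
    using finE disj by (intro card_UN_disjoint) simp_all
  also have "\<dots> = Suc m * ((t + m - 1) choose m)"
    using n by (simp add: card_nat_functions_sum_gt)
  finally have E: "card (\<Union>i. ?E i) = Suc m * ((t + m - 1) choose m)" .
  have "card ?S = card ?B + card (\<Union>i. ?E i)"
    unfolding S
  proof (rule card_Un_disjoint)
    show "finite ?B" by (rule finite_subset[OF _ fin]) blast
    show "finite (\<Union>i. ?E i)" using finE by simp
    show "?B \<inter> (\<Union>i. ?E i) = {}" by (auto simp: not_le[symmetric])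
  qed
  moreover have "card ?S = (2 * t + m) choose m"
    using n by (simp add: card_nat_functions_sum) (subst binomial_symmetric, auto)
  ultimately have "(2 * t + m) choose m = card ?B + Suc m * ((t + m - 1) choose m)"
    using E by simp
  then show ?thesis by (simp only: of_nat_add of_nat_mult)
qed

section \<open>Power series computation of the numerator\<close>

text \<open>This is the expansion of 1 / (1 - z)^(m + 1).\<close>

definition shifted_binomial_fps :: "nat \<Rightarrow> int fps" where
  "shifted_binomial_fps m = Abs_fps (\<lambda>t. int ((t + m) choose m))"

text \<open>Multiplying by \<open>1 - fps_X\<close> takes differences of consecutive coefficients,
  and by Pascal's rule this lowers \<open>m\<close> by one.\<close>

lemma shifted_binomial_fps_mult: "shifted_binomial_fps m * (1 - fps_X) ^ Suc m = 1"
proof (induction m)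
  case 0
  show ?case
    by (rule fps_ext) (auto simp: shifted_binomial_fps_def algebra_simps fps_X_mult_nth)
next
  case (Suc m)
  have "shifted_binomial_fps (Suc m) * (1 - fps_X) = shifted_binomial_fps m"
  proof (rule fps_ext)
    fix t
    show "fps_nth (shifted_binomial_fps (Suc m) * (1 - fps_X)) t = fps_nth (shifted_binomial_fps m) t"
      by (cases t) (simp_all add: shifted_binomial_fps_def right_diff_distrib)
  qed
  then show ?case
    using Suc by (metis mult.assoc power_Suc)
qed


lemma fps_nth_one_plus_X_power:
  "fps_nth ((1 + fps_X) ^ n :: 'a::comm_ring_1 fps) k = of_nat (n choose k)"
proof (induction n arbitrary: k)
  case 0
  show ?case by (cases k) auto
next
  case (Suc n)
  show ?case by (cases k) (simp_all add: distrib_right Suc)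
qed

text \<open>A series in z^2 has only even exponents, so an even coefficient of the product sees only
  the even coefficients of \<open>G\<close>: taking the even part commutes with multiplication by
  F(z^2).\<close>

lemma fps_nth_mult_compose_square:
  fixes F G :: "'a::comm_ring_1 fps"
  shows "fps_nth (G * fps_compose F (fps_X ^ 2)) (2 * k) =
    fps_nth (Abs_fps (\<lambda>t. fps_nth G (2 * t)) * F) k"
proof -
  have nth: "fps_nth (fps_compose F (fps_X ^ 2)) i = (if even i then fps_nth F (i div 2) else 0)" for i
    by (simp add: fps_nth_compose_X_power)
  have "fps_nth (G * fps_compose F (fps_X ^ 2)) (2 * k) =
      (\<Sum>i\<in>{0..2 * k}. fps_nth G i * (if even (2 * k - i) then fps_nth F ((2 * k - i) div 2) else 0))"
    by (simp add: fps_mult_nth nth)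
  also have "\<dots> = (\<Sum>i\<in>(*) 2 ` {0..k}. fps_nth G i * fps_nth F ((2 * k - i) div 2))"
    by (rule sum.mono_neutral_cong_right) (auto elim!: evenE)
  also have "\<dots> = (\<Sum>i\<in>{0..k}. fps_nth G (2 * i) * fps_nth F (k - i))"
    by (subst sum.reindex) (auto simp: inj_on_def simp flip: diff_mult_distrib2)
  finally show ?thesis by (simp add: fps_mult_nth)
qed

text \<open>Take \<open>G\<close> = 1 / (1 - z)^(m + 1) and \<open>F\<close> = (1 - z)^(m + 1).
  Since 1 - z^2 = (1 - z)(1 + z), the product G(z) F(z^2) collapses to (1 + z)^(m + 1), whose
  coefficient at 2k is the binomial.\<close>

lemma even_shifted_binomial_fps_mult:
  "fps_nth (Abs_fps (\<lambda>t. int ((2 * t + m) choose m)) * (1 - fps_X) ^ Suc m) k =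
     int (Suc m choose (2 * k))"
proof -
  have "fps_compose ((1 - fps_X) ^ Suc m) (fps_X ^ 2) = ((1 - fps_X ^ 2) ^ Suc m :: int fps)"
    by (subst fps_compose_power[symmetric]) (simp_all add: fps_compose_sub_distrib)
  also have "\<dots> = (1 - fps_X) ^ Suc m * (1 + fps_X) ^ Suc m"
    by (simp only: power_mult_distrib[symmetric]) (simp add: power2_eq_square algebra_simps)
  finally have "shifted_binomial_fps m * fps_compose ((1 - fps_X) ^ Suc m) (fps_X ^ 2) = (1 + fps_X) ^ Suc m"
    using shifted_binomial_fps_mult[of m] by (metis mult.assoc mult_1)
  moreover have "Abs_fps (\<lambda>t. int ((2 * t + m) choose m)) =
      Abs_fps (\<lambda>t. fps_nth (shifted_binomial_fps m) (2 * t))"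
    by (simp add: shifted_binomial_fps_def)
  ultimately show ?thesis
    using fps_nth_mult_compose_square[of "shifted_binomial_fps m" "(1 - fps_X) ^ Suc m" k]
    by (simp only: fps_nth_one_plus_X_power)
qed

text \<open>The subtracted term has generating function (m + 1) z / (1 - z)^(m + 1), so after
  multiplication only (m + 1) z remains and only \<open>k = 1\<close> is corrected.\<close>

lemma uniform_2_ehrhart_numerator:
  assumes "m > 0"
  shows "fps_nth (Abs_fps (\<lambda>t. int ((2 * t + m) choose m) - int (Suc m) * int ((t + m - 1) choose m))
      * (1 - fps_X) ^ Suc m) k = int (Suc m choose (2 * k)) - (if k = 1 then int (Suc m) else 0)"
proof -
  have "Abs_fps (\<lambda>t. int ((2 * t + m) choose m) - int (Suc m) * int ((t + m - 1) choose m)) =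
      Abs_fps (\<lambda>t. int ((2 * t + m) choose m)) - of_nat (Suc m) * (fps_X * shifted_binomial_fps m)"
  proof (rule fps_ext)
    fix t
    show "fps_nth (Abs_fps (\<lambda>t. int ((2 * t + m) choose m) - int (Suc m) * int ((t + m - 1) choose m))) t =
      fps_nth (Abs_fps (\<lambda>t. int ((2 * t + m) choose m)) - of_nat (Suc m) * (fps_X * shifted_binomial_fps m)) t"
      using assms by (cases t) (simp_all add: shifted_binomial_fps_def fps_of_nat[symmetric] del: of_nat_Suc)
  qed
  then have "Abs_fps (\<lambda>t. int ((2 * t + m) choose m) - int (Suc m) * int ((t + m - 1) choose m)) * (1 - fps_X) ^ Suc m
     = Abs_fps (\<lambda>t. int ((2 * t + m) choose m)) * (1 - fps_X) ^ Suc m -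
       of_nat (Suc m) * fps_X * (shifted_binomial_fps m * (1 - fps_X) ^ Suc m)"
    by (simp only: left_diff_distrib mult.assoc)
  then show ?thesis
    unfolding shifted_binomial_fps_mult
    by (simp add: even_shifted_binomial_fps_mult fps_of_nat[symmetric] del: of_nat_Suc power_Suc)
qed

section \<open>Lattice points and dimension of the polytope\<close>

lemma axis_pair_in_uniform_2_polytope:
  "i \<noteq> j \<Longrightarrow> axis i 1 + axis j 1 \<in> (matroid_polytope (uniform_matroid_bases 2) :: (real ^ 'n::finite) set)"
  unfolding matroid_polytope_uniform_2 by (intro hull_inc) blast

text \<open>The three conditions cut out a convex set containing every vertex, hence the
  hull.\<close>

lemma uniform_2_polytope_bounds:
  fixes x :: "real ^ 'n::finite"
  assumes "x \<in> matroid_polytope (uniform_matroid_bases 2)"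
  shows "0 \<le> x $ i" "x $ i \<le> 1" "(\<Sum>i\<in>UNIV. x $ i) = 2"
proof -
  let ?H = "{x :: real ^ 'n. (\<forall>i. 0 \<le> x $ i \<and> x $ i \<le> 1) \<and> (\<Sum>i\<in>UNIV. x $ i) = 2}"
  have "convex ?H"
    by (auto simp: convex_def sum.distrib sum_distrib_left[symmetric] intro!: convex_bound_le)
  moreover have "{axis i 1 + axis j 1 | i j :: 'n. i \<noteq> j} \<subseteq> ?H"
    by (auto simp: sum.distrib) (auto simp: axis_def)
  ultimately have "matroid_polytope (uniform_matroid_bases 2) \<subseteq> ?H"
    unfolding matroid_polytope_uniform_2 by (rule hull_minimal[rotated])
  then show "0 \<le> x $ i" "x $ i \<le> 1" "(\<Sum>i\<in>UNIV. x $ i) = 2"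
    using assms by auto
qed

text \<open>Take \<open>i\<close> and \<open>j\<close> to be positions of the two largest entries. A
  third entry equal to \<open>t + 1\<close> would push the sum to at least
  \<open>3 * (t + 1)\<close>; a vanishing second entry would force \<open>f i = 2 * (t + 1)\<close>,
  above the bound.\<close>

lemma obtain_pair_of_largest_entries:
  fixes f :: "'a::finite \<Rightarrow> nat"
  assumes le: "\<And>i. f i \<le> Suc t" and sum: "sum f UNIV = 2 * Suc t"
  obtains i j where "i \<noteq> j" "f i > 0" "f j > 0" "\<And>k. k \<noteq> i \<Longrightarrow> k \<noteq> j \<Longrightarrow> f k \<le> t"
proof -
  have "Max (range f) \<in> range f" by (intro Max_in) auto
  then obtain i where "f i = Max (range f)" by force
  then have i: "f k \<le> f i" for k by simp
  have rem: "sum f UNIV = f i + sum f (UNIV - {i})" by (subst sum.remove[of _ i]) auto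
  have pos: "sum f (UNIV - {i}) > 0" using rem sum le[of i] by simp
  then have ne: "UNIV - {i} \<noteq> {}" by (metis sum.empty less_irrefl)
  then have "Max (f ` (UNIV - {i})) \<in> f ` (UNIV - {i})" by (intro Max_in) auto
  then obtain j where j: "j \<noteq> i" "f j = Max (f ` (UNIV - {i}))" by force
  have jmax: "f k \<le> f j" if "k \<noteq> i" for k
    unfolding j(2) using that by (intro Max_ge) auto
  have fj: "f j > 0"
  proof (rule ccontr)
    assume "\<not> f j > 0"
    then have "sum f (UNIV - {i}) = 0" using jmax by fastforce
    with pos show False by simp
  qed
  have "f k \<le> t" if "k \<noteq> i" "k \<noteq> j" for k
  proof (rule ccontr)
    assume k: "\<not> f k \<le> t"
    have "sum f {i, j, k} \<le> sum f UNIV" by (rule sum_mono2) auto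
    with that j have "f i + f j + f k \<le> 2 * Suc t" using sum by simp
    with k jmax[of k] i[of k] that show False by simp
  qed
  then show ?thesis using that[of i j] j fj i[of j] by simp
qed

text \<open>Subtracting one from the two largest entries drops a lattice point of \<open>(t + 1) P\<close> into \<open>t P\<close>.\<close>

lemma lattice_point_in_dilate:
  fixes f :: "'n::finite \<Rightarrow> nat"
  assumes "CARD('n) \<ge> 2" "\<And>i. f i \<le> t" "sum f UNIV = 2 * t"
  shows "(\<chi> i. real (f i)) \<in> (*\<^sub>R) (real t) ` matroid_polytope (uniform_matroid_bases 2)"
  using assms(2,3)
proof (induction t arbitrary: f)
  case 0
  \<comment> \<open>The zero vector lies in the dilate by 0 only if the polytope is nonempty, so
    some vertex is exhibited.\<close>
  obtain i j :: 'n where "i \<noteq> j"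
    using assms(1) card_2_iff obtain_subset_with_card_n by metis
  moreover have "(\<chi> i. real (f i)) = 0" using 0 by (simp add: vec_eq_iff)
  ultimately show ?case using axis_pair_in_uniform_2_polytope[of i j] by (auto intro!: image_eqI[of _ _ "axis i 1 + axis j 1"])
next
  case (Suc t)
  let ?P = "matroid_polytope (uniform_matroid_bases 2) :: (real ^ 'n) set"
  obtain i j where ij: "i \<noteq> j" "f i > 0" "f j > 0" "\<And>k. k \<noteq> i \<Longrightarrow> k \<noteq> j \<Longrightarrow> f k \<le> t"
    using obtain_pair_of_largest_entries[of f t] Suc.prems by blast
  define g where "g = (\<lambda>k. if k = i \<or> k = j then f k - 1 else f k)"
  have fg: "f k = g k + (if k = i then 1 else 0) + (if k = j then 1 else 0)" for k
    using ij by (auto simp: g_def)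
  have "sum f UNIV = sum g UNIV + 2" by (simp add: fg sum.distrib)
  then have "sum g UNIV = 2 * t" using Suc.prems by simp
  moreover have "g k \<le> t" for k
    using ij Suc.prems(1)[of k] by (auto simp: g_def)
  ultimately have "(\<chi> i. real (g i)) \<in> (*\<^sub>R) (real t) ` ?P" by (intro Suc.IH) auto
  then obtain p where p: "p \<in> ?P" "(\<chi> i. real (g i)) = real t *\<^sub>R p" by auto
  define v :: "real ^ 'n" where "v = axis i 1 + axis j 1"
  have v: "v \<in> ?P" unfolding v_def by (rule axis_pair_in_uniform_2_polytope[OF ij(1)])
  have "(\<chi> k. real (f k)) = real t *\<^sub>R p + v"
    unfolding p(2)[symmetric] by (auto simp: vec_eq_iff fg v_def axis_def)
  \<comment> \<open>Factoring out \<open>t + 1\<close> leaves weights \<open>t / (t + 1)\<close> and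
    \<open>1 / (t + 1)\<close>, a convex combination of \<open>p\<close> and
    \<open>v\<close>.\<close>
  also have "\<dots> = real (Suc t) *\<^sub>R ((real t / real (Suc t)) *\<^sub>R p + (1 / real (Suc t)) *\<^sub>R v)"
    by (simp add: scaleR_add_right del: of_nat_Suc)
  finally have eq: "(\<chi> k. real (f k)) = real (Suc t) *\<^sub>R ((real t / real (Suc t)) *\<^sub>R p + (1 / real (Suc t)) *\<^sub>R v)" .
  have "convex ?P" unfolding matroid_polytope_def by (rule convex_convex_hull)
  then have "(real t / real (Suc t)) *\<^sub>R p + (1 / real (Suc t)) *\<^sub>R v \<in> ?P"
    by (rule convexD) (use p v in \<open>auto simp: field_simps\<close>)
  with eq show ?case by blast
qed

lemma lattice_point_count_uniform_2:
  assumes "CARD('n::finite) \<ge> 2"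
  shows "lattice_point_count (matroid_polytope (uniform_matroid_bases 2) :: (real ^ 'n) set) t =
    card {f::'n \<Rightarrow> nat. (\<forall>i. f i \<le> t) \<and> sum f UNIV = 2 * t}"
proof -
  let ?P = "matroid_polytope (uniform_matroid_bases 2) :: (real ^ 'n) set"
  let ?v = "\<lambda>f::'n \<Rightarrow> nat. (\<chi> i. real (f i))"
  have "bij_betw ?v {f. (\<forall>i. f i \<le> t) \<and> sum f UNIV = 2 * t}
     {x \<in> (*\<^sub>R) (real t) ` ?P. \<forall>i. x $ i \<in> \<int>}"
    unfolding bij_betw_def
  proof (intro conjI equalityI subsetI)
    show "inj_on ?v {f. (\<forall>i. f i \<le> t) \<and> sum f UNIV = 2 * t}"
      by (auto simp: inj_on_def vec_eq_iff)
    show "x \<in> {x \<in> (*\<^sub>R) (real t) ` ?P. \<forall>i. x $ i \<in> \<int>}"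
      if x: "x \<in> ?v ` {f. (\<forall>i. f i \<le> t) \<and> sum f UNIV = 2 * t}" for x
    proof -
      obtain f where f: "x = ?v f" "\<And>i. f i \<le> t" "sum f UNIV = 2 * t" using x by blast
      then have "x \<in> (*\<^sub>R) (real t) ` ?P" using lattice_point_in_dilate[OF assms, of f t] by simp
      moreover have "\<forall>i. x $ i \<in> \<int>" using f(1) by simp
      ultimately show ?thesis by blast
    qed
    show "x \<in> ?v ` {f. (\<forall>i. f i \<le> t) \<and> sum f UNIV = 2 * t}"
      if x: "x \<in> {x \<in> (*\<^sub>R) (real t) ` ?P. \<forall>i. x $ i \<in> \<int>}" for x
    proof -
      obtain p where p: "p \<in> ?P" "x = real t *\<^sub>R p" using x by auto
      have b: "0 \<le> x $ i" "x $ i \<le> real t" for i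
        using uniform_2_polytope_bounds(1,2)[OF p(1), of i] p(2) by (auto simp: mult_left_le)
      have s: "(\<Sum>i\<in>UNIV. x $ i) = 2 * real t"
        using uniform_2_polytope_bounds(3)[OF p(1)] p(2) by (simp add: sum_distrib_left[symmetric])
      \<comment> \<open>The floor loses nothing, because the entries of \<open>x\<close> are
        nonnegative integers.\<close>
      define f where "f = (\<lambda>i. nat \<lfloor>x $ i\<rfloor>)"
      have f: "real (f i) = x $ i" for i
      proof -
        have "x $ i \<in> \<int>" using x by simp
        then obtain z where z: "x $ i = of_int z" by (rule Ints_cases)
        then show ?thesis using b(1)[of i] by (simp add: f_def)
      qed
      have "real (sum f UNIV) = real (2 * t)" using s by (simp add: f)
      then have "sum f UNIV = 2 * t" by (simp only: of_nat_eq_iff)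
      moreover have "f i \<le> t" for i using b(2)[of i] unfolding f[symmetric] of_nat_le_iff .
      ultimately have "f \<in> {f. (\<forall>i. f i \<le> t) \<and> sum f UNIV = 2 * t}" by simp
      then have "?v f \<in> ?v ` {f. (\<forall>i. f i \<le> t) \<and> sum f UNIV = 2 * t}" by (rule imageI)
      moreover have "?v f = x" by (simp add: vec_eq_iff f)
      ultimately show ?thesis by (simp only:)
    qed
  qed
  then show ?thesis unfolding lattice_point_count_def by (rule bij_betw_same_card[symmetric])
qed

text \<open>The points \<open>2 *\<^sub>R axis i 1\<close> lie in the affine hull and affinely span
  the hyperplane of coordinate sum 2; reaching them takes three distinct indices.\<close>

lemma aff_dim_uniform_2_polytope:
  assumes "CARD('n::finite) \<ge> 3"
  shows "aff_dim (matroid_polytope (uniform_matroid_bases 2) :: (real ^ 'n) set) = int CARD('n) - 1"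
proof -
  let ?P = "matroid_polytope (uniform_matroid_bases 2) :: (real ^ 'n) set"
  let ?one = "(\<chi> i. 1) :: real ^ 'n"
  let ?H = "{x. ?one \<bullet> x = 2}"
  have inner: "?one \<bullet> x = (\<Sum>i\<in>UNIV. x $ i)" for x by (simp add: inner_vec_def)
  have "affine hull ?P = ?H"
  proof (intro equalityI subsetI)
    have "?P \<subseteq> ?H" using uniform_2_polytope_bounds(3) by (auto simp: inner)
    then show "x \<in> ?H" if "x \<in> affine hull ?P" for x
      using that hull_minimal[of ?P ?H affine] affine_hyperplane by blast
  next
    fix x assume x: "x \<in> ?H"
    have two: "2 *\<^sub>R axis i 1 \<in> affine hull ?P" for i :: 'n
    proof -
      have "2 \<le> card (UNIV - {i})" using assms by (simp add: card_Diff_singleton)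
      then obtain T where "T \<subseteq> UNIV - {i}" "card T = 2" by (metis obtain_subset_with_card_n)
      then obtain j k where jk: "j \<noteq> k" "i \<noteq> j" "i \<noteq> k" by (auto simp: card_2_iff)
      \<comment> \<open>\<open>2 e\<^sub>i = (e\<^sub>i + e\<^sub>j) + (e\<^sub>i + e\<^sub>k) - (e\<^sub>j + e\<^sub>k)\<close> is an affine combination of vertices.\<close>
      have "1 *\<^sub>R (axis i 1 + axis j 1) + 1 *\<^sub>R (axis i 1 + axis k 1) + (-1) *\<^sub>R (axis j 1 + axis k 1)
          \<in> affine hull ?P"
        by (rule mem_affine_3) (use jk in \<open>auto intro!: hull_inc axis_pair_in_uniform_2_polytope\<close>)
      then show ?thesis by (simp add: scaleR_2 algebra_simps)
    qed
    let ?e = "\<lambda>i::'n. 2 *\<^sub>R axis i (1::real)"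
    have inj: "inj ?e" by (auto simp: inj_on_def axis_eq_axis)
    \<comment> \<open>Affine combinations are taken here over sets of vectors, so the weight of a
      point \<open>?e i\<close> is found through \<open>inv ?e\<close>. The weights
      \<open>x $ i / 2\<close> sum to 1 because \<open>x\<close> has coordinate sum 2.\<close>
    define u where "u = (\<lambda>v. x $ (inv ?e v) / 2)"
    have ue: "u (?e i) = x $ i / 2" for i unfolding u_def by (simp only: inv_f_f[OF inj])
    have "sum u (range ?e) = (\<Sum>i\<in>UNIV. u (?e i))" by (subst sum.reindex[OF inj]) simp
    also have "\<dots> = 1" using x by (simp only: ue) (simp add: inner sum_divide_distrib[symmetric])
    finally have "(\<Sum>v\<in>range ?e. u v *\<^sub>R v) \<in> affine hull ?P"
      using affine_affine_hull[of ?P, unfolded affine[of "affine hull ?P"], rule_format, of "range ?e" u] two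
      by (simp add: image_subset_iff)
    also have "(\<Sum>v\<in>range ?e. u v *\<^sub>R v) = (\<Sum>i\<in>UNIV. u (?e i) *\<^sub>R ?e i)"
      by (subst sum.reindex[OF inj]) simp
    also have "\<dots> = (\<Sum>i\<in>UNIV. x $ i *\<^sub>R axis i 1)" by (simp only: ue) simp
    also have "\<dots> = x" using basis_expansion[of x] by (simp add: scalar_mult_eq_scaleR)
    finally show "x \<in> affine hull ?P" .
  qed
  then have "aff_dim ?P = aff_dim ?H" by (metis aff_dim_affine_hull)
  also have "\<dots> = int CARD('n) - 1"
    by (subst aff_dim_hyperplane) (auto simp: vec_eq_iff)
  finally show ?thesis .
qed

section \<open>Permutations with one descent\<close>

text \<open>Each maximal interval of a finite set is represented by its largest element, so the
  cardinality counts the intervals.\<close>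

definition block_ends :: "nat set \<Rightarrow> nat set" where
  "block_ends A = {a \<in> A. Suc a \<notin> A}"

lemma finite_block_ends: "finite A \<Longrightarrow> finite (block_ends A)"
  by (simp add: block_ends_def)

text \<open>The new top element is always an end: it replaces \<open>m\<close> when it prolongs the
  interval ending there, and otherwise opens a new interval.\<close>

lemma card_block_ends_insert:
  assumes "A \<subseteq> {1..m}"
  shows "card (block_ends (insert (Suc m) A)) = card (block_ends A) + (if m \<in> A then 0 else 1)"
proof -
  have fin: "finite A" using assms finite_subset by blast
  have eq: "block_ends (insert (Suc m) A) = insert (Suc m) (block_ends A - {m})"
    using assms by (force simp: block_ends_def)
  have "Suc m \<notin> block_ends A - {m}" using assms by (auto simp: block_ends_def)
  then have c: "card (block_ends (insert (Suc m) A)) = Suc (card (block_ends A - {m}))"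
    unfolding eq using fin by (simp add: finite_block_ends)
  show ?thesis
  proof (cases "m \<in> A")
    case True
    then have "m \<in> block_ends A" using assms by (auto simp: block_ends_def)
    then have "Suc (card (block_ends A - {m})) = card (block_ends A)"
      using fin by (intro card_Suc_Diff1) (simp add: finite_block_ends)
    with True c show ?thesis by simp
  next
    case False
    then have "block_ends A - {m} = block_ends A" by (auto simp: block_ends_def)
    with False c show ?thesis by simp
  qed
qed

text \<open>Whether \<open>m\<close> belongs to the set decides how adding \<open>m + 1\<close>
  changes the number of intervals, so the two counts are proved together; their recurrences are
  Pascal's rule.\<close>

lemma card_subsets_block_ends_last:
  "card {A. A \<subseteq> {1..m} \<and> m \<notin> A \<and> card (block_ends A) = k} = m choose (2 * k) \<and>
   card {A. A \<subseteq> {1..m} \<and> m \<in> A \<and> card (block_ends A) = Suc k} = m choose (2 * k + 1)"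
proof (induction m arbitrary: k)
  case 0
  have "{A. A \<subseteq> {1..0} \<and> 0 \<notin> A \<and> card (block_ends A) = k} = (if k = 0 then {{}} else {})"
    by (auto simp: block_ends_def)
  then show ?case by auto
next
  case (Suc m)
  let ?N = "\<lambda>m k. {A. A \<subseteq> {1..m} \<and> m \<notin> A \<and> card (block_ends A) = k}"
  let ?I = "\<lambda>m k. {A. A \<subseteq> {1..m} \<and> m \<in> A \<and> card (block_ends A) = k}"
  have fin: "finite (?N m k)" "finite (?I m k)" for m k
    by (auto intro: finite_subset[of _ "Pow {1..m}"])
  \<comment> \<open>The induction hypothesis counts sets containing \<open>m\<close> only for a
    positive number of intervals; this supplies the missing value at 0.\<close>
  have I0: "?I m 0 = {}"
  proof -
    { fix A assume A: "A \<subseteq> {1..m}" "m \<in> A" "card (block_ends A) = 0"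
      then have "finite A" using finite_subset by blast
      moreover have "m \<in> block_ends A" using A by (auto simp: block_ends_def)
      ultimately have False using A(3) by (auto simp: finite_block_ends) }
    then show ?thesis by blast
  qed
  have sub: "A \<subseteq> {1..Suc m} \<and> Suc m \<notin> A \<longleftrightarrow> A \<subseteq> {1..m}" for A
    by (force simp: atLeastAtMostSuc_conv)
  have N: "?N (Suc m) k = ?N m k \<union> ?I m k" for k using sub by blast
  have cN: "card (?N (Suc m) k) = card (?N m k) + card (?I m k)" for k
    unfolding N by (rule card_Un_disjoint) (use fin in auto)
  have I: "?I (Suc m) (Suc k) = insert (Suc m) ` (?I m (Suc k) \<union> ?N m k)" for k
  proof (intro equalityI subsetI)
    fix A assume A: "A \<in> ?I (Suc m) (Suc k)"
    define B where "B = A - {Suc m}"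
    have B: "A = insert (Suc m) B" "B \<subseteq> {1..m}"
      using A sub[of B] unfolding B_def by auto
    then have "B \<in> ?I m (Suc k) \<union> ?N m k"
      using A card_block_ends_insert[OF B(2)] by (auto split: if_splits)
    with B show "A \<in> insert (Suc m) ` (?I m (Suc k) \<union> ?N m k)" by blast
  next
    fix A assume "A \<in> insert (Suc m) ` (?I m (Suc k) \<union> ?N m k)"
    then obtain B where B: "A = insert (Suc m) B" "B \<in> ?I m (Suc k) \<union> ?N m k" by blast
    then have "B \<subseteq> {1..m}" by blast
    with B card_block_ends_insert[OF this] show "A \<in> ?I (Suc m) (Suc k)" by auto
  qed
  have inj: "inj_on (insert (Suc m)) (?I m (Suc k) \<union> ?N m k)" for k
  proof (rule inj_onI)
    fix A B assume AB: "A \<in> ?I m (Suc k) \<union> ?N m k" "B \<in> ?I m (Suc k) \<union> ?N m k" "insert (Suc m) A = insert (Suc m) B"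
    then have "Suc m \<notin> A" "Suc m \<notin> B" by auto
    with AB(3) show "A = B" by (metis insert_ident)
  qed
  have cI: "card (?I (Suc m) (Suc k)) = card (?I m (Suc k)) + card (?N m k)" for k
    unfolding I card_image[OF inj] by (rule card_Un_disjoint) (use fin in auto)
  have "card (?N (Suc m) k) = Suc m choose (2 * k)"
  proof (cases k)
    case 0
    then show ?thesis using cN[of 0] I0 Suc.IH[of 0] by simp
  next
    case (Suc l)
    then show ?thesis using cN[of "Suc l"] Suc.IH[of l] Suc.IH[of "Suc l"] by simp
  qed
  moreover have "card (?I (Suc m) (Suc k)) = Suc m choose (2 * k + 1)"
    using cI[of k] Suc.IH[of k] by simp
  ultimately show ?case ..
qed

text \<open>Subsets of \<open>{1..m}\<close> are the subsets of \<open>{1..Suc m}\<close> that avoid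
  the top element, which explains the upper index.\<close>

lemma card_subsets_block_ends:
  "card {A. A \<subseteq> {1..m} \<and> card (block_ends A) = k} = Suc m choose (2 * k)"
proof -
  have "A \<subseteq> {1..m} \<longleftrightarrow> A \<subseteq> {1..Suc m} \<and> Suc m \<notin> A" for A
    by (force simp: atLeastAtMostSuc_conv)
  then have "{A. A \<subseteq> {1..m} \<and> card (block_ends A) = k} =
      {A. A \<subseteq> {1..Suc m} \<and> Suc m \<notin> A \<and> card (block_ends A) = k}" by blast
  then show ?thesis using card_subsets_block_ends_last[of "Suc m" k] by simp
qed

text \<open>Excludes exactly the initial segments \<open>{1..j}\<close>, the empty one included,
  among subsets of \<open>{1..m}\<close>. The pair \<open>b < a\<close> is what later produces the
  descent.\<close>

definition non_initial :: "nat \<Rightarrow> nat set \<Rightarrow> bool" where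
  "non_initial m A \<longleftrightarrow> A \<subseteq> {1..m} \<and> (\<exists>a\<in>A. \<exists>b\<in>{1..m} - A. b < a)"

lemma block_ends_initial: "j \<ge> 1 \<Longrightarrow> block_ends {1..j} = {j}"
  by (auto simp: block_ends_def)

lemma not_non_initial_iff:
  assumes "A \<subseteq> {1..m}" "A \<noteq> {}"
  shows "\<not> non_initial m A \<longleftrightarrow> A \<in> (\<lambda>j. {1..j}) ` {1..m}"
proof
  assume ini: "\<not> non_initial m A"
  have fin: "finite A" using assms(1) by (rule finite_subset) simp
  have mx: "Max A \<in> A" using fin assms(2) by (rule Max_in)
  \<comment> \<open>A missing value below \<open>Max A\<close> would witness
    \<open>non_initial\<close>, so \<open>A\<close> must be \<open>{1..Max A}\<close>.\<close>
  have "x \<in> A" if x: "1 \<le> x" "x \<le> Max A" for x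
  proof (rule ccontr)
    assume "x \<notin> A"
    then have "x < Max A" using mx x(2) by (metis le_neq_implies_less)
    moreover have "x \<in> {1..m} - A"
      using \<open>x \<notin> A\<close> x subsetD[OF assms(1) mx] by simp
    ultimately show False using ini mx assms(1) unfolding non_initial_def by blast
  qed
  moreover have "1 \<le> x \<and> x \<le> Max A" if "x \<in> A" for x
    using subsetD[OF assms(1) that] Max_ge[OF fin that] by simp
  ultimately have "A = {1..Max A}" by (intro set_eqI) (metis atLeastAtMost_iff)
  moreover have "Max A \<in> {1..m}" using assms(1) mx by (rule subsetD)
  ultimately show "A \<in> (\<lambda>j. {1..j}) ` {1..m}" by (rule image_eqI)
next
  assume "A \<in> (\<lambda>j. {1..j}) ` {1..m}"
  then show "\<not> non_initial m A" by (auto simp: non_initial_def)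
qed

text \<open>A nonempty initial segment is a single interval, and the empty one has no block end, so
  only \<open>k = 0\<close> loses sets.\<close>

lemma initial_sets:
  "{A. A \<subseteq> {1..m} \<and> card (block_ends A) = Suc k \<and> \<not> non_initial m A} =
     (if k = 0 then (\<lambda>j. {1..j}) ` {1..m} else {})"
proof -
  let ?J = "(\<lambda>j. {1..j}) ` {1..m}"
  have J: "A \<subseteq> {1..m} \<and> A \<noteq> {} \<and> card (block_ends A) = Suc 0" if A: "A \<in> ?J" for A
  proof -
    obtain j where j: "A = {1..j}" "1 \<le> j" "j \<le> m" using A by (auto simp del: One_nat_def)
    then show ?thesis using block_ends_initial[OF j(2)] by simp
  qed
  have ne: "A \<noteq> {}" if "card (block_ends A) = Suc k" for A
    using that by (auto simp: block_ends_def)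
  have eq: "A \<subseteq> {1..m} \<and> card (block_ends A) = Suc k \<and> \<not> non_initial m A \<longleftrightarrow> A \<in> ?J \<and> k = 0" for A
    using J[of A] ne[of A] not_non_initial_iff[of A m] by (metis nat.inject)
  show ?thesis unfolding eq by (cases "k = 0") simp_all
qed

lemma card_non_initial:
  "int (card {A. non_initial m A \<and> card (block_ends A) = Suc k}) =
     int (Suc m choose (2 * Suc k)) - (if k = 0 then int m else 0)"
proof -
  let ?A = "{A. A \<subseteq> {1..m} \<and> card (block_ends A) = Suc k}"
  let ?B = "{A. A \<subseteq> {1..m} \<and> card (block_ends A) = Suc k \<and> \<not> non_initial m A}"
  let ?C = "{A. non_initial m A \<and> card (block_ends A) = Suc k}"
  have sub: "non_initial m A \<Longrightarrow> A \<subseteq> {1..m}" for A by (simp add: non_initial_def)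
  have "inj_on (\<lambda>j. {1..j}) {1..m}"
    by (auto simp: inj_on_def)
  then have B: "card ?B = (if k = 0 then m else 0)"
    unfolding initial_sets by (simp add: card_image)
  have "?A = ?C \<union> ?B" using sub by blast
  moreover have "card (?C \<union> ?B) = card ?C + card ?B"
    by (rule card_Un_disjoint) (auto intro: finite_subset[of _ "Pow {1..m}"] dest: sub)
  ultimately have "Suc m choose (2 * Suc k) = card ?C + card ?B"
    using card_subsets_block_ends[of m "Suc k"] by simp
  then show ?thesis using B by simp
qed

section \<open>From a permutation to its set of values before the descent\<close>

lemma less_of_Suc_steps:
  fixes f :: "nat \<Rightarrow> nat"
  assumes "\<And>i. a \<le> i \<Longrightarrow> i < b \<Longrightarrow> f i < f (Suc i)" "a \<le> i" "i < j" "j \<le> b"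
  shows "f i < f j"
  using assms(3,4)
proof (induction j)
  case (Suc j)
  then show ?case using assms(1)[of j] assms(2) by (cases "i = j") auto
qed simp

text \<open>Injectivity makes every non-descent a strict ascent, so the unique descent splits the
  one-line notation into two strictly increasing runs.\<close>

lemma one_descentE:
  assumes "\<pi> \<in> perms_with_descents 1 m"
  obtains d where "descent_pos m \<pi> = d" "1 \<le> d" "d < m" "\<pi> permutes {1..m}" "\<pi> (Suc d) < \<pi> d"
    "\<And>i j. 1 \<le> i \<Longrightarrow> i < j \<Longrightarrow> j \<le> d \<Longrightarrow> \<pi> i < \<pi> j"
    "\<And>i j. Suc d \<le> i \<Longrightarrow> i < j \<Longrightarrow> j \<le> m \<Longrightarrow> \<pi> i < \<pi> j"
proof -
  have p: "\<pi> permutes {1..m}" "card (descents m \<pi>) = 1"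
    using assms by (auto simp: perms_with_descents_def)
  then obtain d where d: "descents m \<pi> = {d}" by (auto simp: card_1_singleton_iff)
  have pos: "descent_pos m \<pi> = d" by (simp add: descent_pos_def d)
  have dd: "1 \<le> d" "d < m" "\<pi> (Suc d) < \<pi> d"
    using d by (auto simp: descents_def)
  have step: "\<pi> i < \<pi> (Suc i)" if "1 \<le> i" "i < m" "i \<noteq> d" for i
  proof -
    have "i \<notin> descents m \<pi>" using that d by simp
    then have "\<pi> i \<le> \<pi> (Suc i)" using that by (simp add: descents_def)
    moreover have "\<pi> i \<noteq> \<pi> (Suc i)"
      using permutes_inj[OF p(1)] by (simp add: inj_eq)
    ultimately show ?thesis by simp
  qed
  show ?thesis
  proof (rule that[OF pos dd(1,2) p(1) dd(3)])
    show "\<pi> i < \<pi> j" if "1 \<le> i" "i < j" "j \<le> d" for i j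
      by (rule less_of_Suc_steps[of 1 d]) (use that step dd in auto)
    show "\<pi> i < \<pi> j" if "Suc d \<le> i" "i < j" "j \<le> m" for i j
      by (rule less_of_Suc_steps[of "Suc d" m]) (use that step dd in auto)
  qed
qed

definition initial_values :: "nat \<Rightarrow> (nat \<Rightarrow> nat) \<Rightarrow> nat set" where
  "initial_values m \<pi> = \<pi> ` {1..descent_pos m \<pi>}"

text \<open>The values on both sides of the descent are the witnesses: \<open>\<pi> d\<close> is in
  the set and the smaller \<open>\<pi> (Suc d)\<close> is not.\<close>

lemma initial_values_non_initial:
  assumes "\<pi> \<in> perms_with_descents 1 m"
  shows "non_initial m (initial_values m \<pi>)"
proof -
  from assms obtain d where d: "descent_pos m \<pi> = d" "1 \<le> d" "d < m" "\<pi> permutes {1..m}" "\<pi> (Suc d) < \<pi> d"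
    by (rule one_descentE)
  have "\<pi> ` {1..m} = {1..m}" using d(4) by (rule permutes_image)
  then have "\<pi> ` {1..d} \<subseteq> {1..m}" "\<pi> (Suc d) \<in> {1..m}" using d(3) by fastforce+
  moreover have "\<pi> (Suc d) \<notin> \<pi> ` {1..d}"
    using permutes_inj[OF d(4)] by (auto simp: inj_eq)
  moreover have "\<pi> d \<in> \<pi> ` {1..d}" using d(2) by simp
  ultimately show ?thesis
    using d(5) unfolding non_initial_def initial_values_def d(1) by blast
qed

text \<open>Values before the descent increase, so the successor of \<open>\<pi> i\<close> can occur
  only at position \<open>i + 1\<close>. Block ends therefore sit at the gaps and at
  \<open>d\<close> itself, which accounts for the extra one.\<close>

lemma card_block_ends_initial_values:
  assumes "\<pi> \<in> perms_with_descents 1 m"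
  shows "card (block_ends (initial_values m \<pi>)) = Suc (initial_gaps m \<pi>)"
proof -
  from assms obtain d where d: "descent_pos m \<pi> = d" "1 \<le> d" "d < m" "\<pi> permutes {1..m}"
    and mono: "\<And>i j. 1 \<le> i \<Longrightarrow> i < j \<Longrightarrow> j \<le> d \<Longrightarrow> \<pi> i < \<pi> j"
    by (rule one_descentE) blast
  have inj: "inj \<pi>" using d(4) by (rule permutes_inj)
  let ?G = "{i. 1 \<le> i \<and> i < d \<and> \<pi> (i + 1) \<noteq> \<pi> i + 1}"
  have succ: "Suc (\<pi> i) \<in> \<pi> ` {1..d} \<longleftrightarrow> i < d \<and> \<pi> (i + 1) = \<pi> i + 1" if i: "1 \<le> i" "i \<le> d" for i
  proof
    assume "Suc (\<pi> i) \<in> \<pi> ` {1..d}"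
    then obtain j where j: "1 \<le> j" "j \<le> d" "\<pi> j = Suc (\<pi> i)" by auto
    have "i < j" using mono[of j i] i j by (metis lessI less_imp_not_less linorder_neqE_nat n_not_Suc_n)
    moreover have "j = Suc i"
    proof (rule ccontr)
      assume "j \<noteq> Suc i"
      then have "\<pi> i < \<pi> (Suc i)" "\<pi> (Suc i) < \<pi> j"
        using mono[of i "Suc i"] mono[of "Suc i" j] \<open>i < j\<close> i j by auto
      with j show False by simp
    qed
    ultimately show "i < d \<and> \<pi> (i + 1) = \<pi> i + 1" using j by auto
  next
    assume "i < d \<and> \<pi> (i + 1) = \<pi> i + 1"
    then show "Suc (\<pi> i) \<in> \<pi> ` {1..d}" using i by (intro image_eqI[of _ _ "i + 1"]) auto
  qed
  have "block_ends (\<pi> ` {1..d}) = \<pi> ` {i \<in> {1..d}. Suc (\<pi> i) \<notin> \<pi> ` {1..d}}"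
    by (auto simp: block_ends_def)
  also have "{i \<in> {1..d}. Suc (\<pi> i) \<notin> \<pi> ` {1..d}} = insert d ?G"
  proof (rule set_eqI)
    fix i
    show "i \<in> {i \<in> {1..d}. Suc (\<pi> i) \<notin> \<pi> ` {1..d}} \<longleftrightarrow> i \<in> insert d ?G"
      using succ[of i] d(2) by (cases "1 \<le> i \<and> i \<le> d") (simp_all, linarith+)
  qed
  finally have "card (block_ends (\<pi> ` {1..d})) = card (insert d ?G)"
    using card_image[OF inj_on_subset[OF inj subset_UNIV]] by metis
  also have "\<dots> = Suc (card ?G)" by (subst card_insert_disjoint) auto
  finally show ?thesis by (simp add: initial_values_def initial_gaps_def d)
qed

section \<open>Recovering the permutation from the set\<close>

text \<open>One-line notation of the Grassmannian permutation attached to \<open>A\<close>.\<close>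

definition grassmannian_word :: "nat \<Rightarrow> nat set \<Rightarrow> nat list" where
  "grassmannian_word m A = sorted_list_of_set A @ sorted_list_of_set ({1..m} - A)"

lemma map_upt_eq_sorted_list_of_set:
  fixes f :: "nat \<Rightarrow> nat"
  assumes "\<And>i j. a \<le> i \<Longrightarrow> i < j \<Longrightarrow> j < b \<Longrightarrow> f i < f j"
  shows "map f [a..<b] = sorted_list_of_set (f ` {a..<b})"
proof -
  have "sorted_wrt (<) (map f [a..<b])"
    unfolding sorted_wrt_iff_nth_less using assms by auto
  then show ?thesis
    by (metis (no_types) image_set set_upt sorted_list_of_set.idem_if_sorted_distinct strict_sorted_iff)
qed

text \<open>Each increasing run is the sorted list of its values, and the second run takes the
  complementary values. Hence the set determines the permutation.\<close>

lemma one_line_eq_grassmannian_word: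
  assumes "\<pi> \<in> perms_with_descents 1 m"
  shows "map \<pi> [1..<Suc m] = grassmannian_word m (initial_values m \<pi>)"
proof -
  from assms obtain d where d: "descent_pos m \<pi> = d" "1 \<le> d" "d < m" "\<pi> permutes {1..m}"
    and mono: "\<And>i j. 1 \<le> i \<Longrightarrow> i < j \<Longrightarrow> j \<le> d \<Longrightarrow> \<pi> i < \<pi> j"
    "\<And>i j. Suc d \<le> i \<Longrightarrow> i < j \<Longrightarrow> j \<le> m \<Longrightarrow> \<pi> i < \<pi> j"
    by (rule one_descentE) blast
  have "map \<pi> [1..<Suc m] = map \<pi> [1..<Suc d] @ map \<pi> [Suc d..<Suc m]"
    using d(3) upt_add_eq_append[of 1 "Suc d" "m - d"] by (simp flip: map_append)
  also have "map \<pi> [1..<Suc d] = sorted_list_of_set (\<pi> ` {1..<Suc d})"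
    by (rule map_upt_eq_sorted_list_of_set) (use mono in auto)
  also have "map \<pi> [Suc d..<Suc m] = sorted_list_of_set (\<pi> ` {Suc d..<Suc m})"
    by (rule map_upt_eq_sorted_list_of_set) (use mono in auto)
  also have "{Suc d..<Suc m} = {1..m} - {1..d}" using d by auto
  also have "\<pi> ` ({1..m} - {1..d}) = {1..m} - \<pi> ` {1..d}"
    using image_set_diff[OF permutes_inj[OF d(4)]] permutes_image[OF d(4)] by metis
  finally show ?thesis
    by (simp add: grassmannian_word_def initial_values_def d(1) atLeastLessThanSuc_atLeastAtMost)
qed

lemma inj_on_initial_values: "inj_on (initial_values m) (perms_with_descents 1 m)"
proof (rule inj_onI)
  fix \<pi> \<sigma> assume a: "\<pi> \<in> perms_with_descents 1 m" "\<sigma> \<in> perms_with_descents 1 m"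
    "initial_values m \<pi> = initial_values m \<sigma>"
  then have "map \<pi> [1..<Suc m] = map \<sigma> [1..<Suc m]" by (simp only: one_line_eq_grassmannian_word)
  then have eq: "\<pi> i = \<sigma> i" if "i \<in> {1..m}" for i using that by (auto simp: le_less)
  have "\<pi> permutes {1..m}" "\<sigma> permutes {1..m}" using a by (auto simp: perms_with_descents_def)
  then show "\<pi> = \<sigma>" using eq by (metis ext permutes_not_in)
qed

text \<open>The Grassmannian word of \<open>A\<close> works: both halves increase, and
  non-initiality forces a descent where they meet.\<close>

lemma grassmannian_permutation:
  assumes "non_initial m A"
  shows "\<exists>\<pi>\<in>perms_with_descents 1 m. initial_values m \<pi> = A"
proof -
  obtain a b where ab: "A \<subseteq> {1..m}" "a \<in> A" "b \<in> {1..m} - A" "b < a"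
    using assms by (auto simp: non_initial_def)
  have fin: "finite A" using ab finite_subset by blast
  define xs ys where "xs = sorted_list_of_set A" and "ys = sorted_list_of_set ({1..m} - A)"
  define d where "d = card A"
  have xs: "set xs = A" "length xs = d" "sorted_wrt (<) xs" "distinct xs"
    using fin by (simp_all add: xs_def d_def)
  have ys: "set ys = {1..m} - A" "length ys = m - d" "sorted_wrt (<) ys" "distinct ys"
    using fin ab(1) by (simp_all add: ys_def d_def card_Diff_subset)
  have d: "1 \<le> d" "d < m"
  proof -
    show "1 \<le> d" using ab(2) xs by (cases xs) auto
    show "d < m" using ab(3) ys by (cases ys) auto
  qed
  have set: "set (xs @ ys) = {1..m}" using xs ys ab(1) by auto
  have len: "length (xs @ ys) = m" using xs ys d by simp
  \<comment> \<open>List positions start at 0 and permutation positions at 1; outside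
    \<open>{1..m}\<close> the identity is required by \<open>permutes\<close>.\<close>
  define \<pi> where "\<pi> = (\<lambda>i. if i \<in> {1..m} then (xs @ ys) ! (i - 1) else i)"
  \<comment> \<open>Used with \<open>k = m\<close> for bijectivity and with \<open>k = d\<close> to
    identify the initial values.\<close>
  have img: "\<pi> ` {1..k} = set (take k (xs @ ys))" if "k \<le> m" for k
  proof -
    have "{1..k} = Suc ` {..<k}" by (simp add: image_Suc_lessThan)
    then have "\<pi> ` {1..k} = (\<lambda>i. \<pi> (Suc i)) ` {..<k}" by (simp only: image_image)
    also have "\<dots> = (\<lambda>i. (xs @ ys) ! i) ` {..<k}"
      by (rule image_cong) (use that in \<open>auto simp: \<pi>_def\<close>)
    also have "\<dots> = set (take k (xs @ ys))"
      using nth_image[of k "xs @ ys"] that len by (simp add: lessThan_atLeast0)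
    finally show ?thesis .
  qed
  have perm: "\<pi> permutes {1..m}"
  proof (rule bij_imp_permutes)
    have "\<pi> ` {1..m} = {1..m}" using img[of m] set len by simp
    then show "bij_betw \<pi> {1..m} {1..m}"
      by (simp add: bij_betw_def finite_surj_inj eq_card_imp_inj_on)
  qed (auto simp: \<pi>_def)
  have x: "\<pi> i = xs ! (i - 1)" if "1 \<le> i" "i \<le> d" for i
    using that d xs by (auto simp: \<pi>_def nth_append)
  have y: "\<pi> i = ys ! (i - 1 - d)" if "d < i" "i \<le> m" for i
    using that d xs by (auto simp: \<pi>_def nth_append)
  have desc: "descents m \<pi> = {d}"
  proof -
    have "\<pi> i < \<pi> (i + 1)" if "1 \<le> i" "i < d" for i
      using that x[of i] x[of "i + 1"] xs(2,3) by (simp add: sorted_wrt_iff_nth_less)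
    moreover have "\<pi> i < \<pi> (i + 1)" if "d < i" "i < m" for i
      using that y[of i] y[of "i + 1"] ys(2,3) by (simp add: sorted_wrt_iff_nth_less)
    moreover have "\<pi> (d + 1) < \<pi> d"
    proof -
      obtain p where p: "p < d" "xs ! p = a" using ab(2) xs by (metis in_set_conv_nth)
      obtain q where q: "q < m - d" "ys ! q = b" using ab(3) ys by (metis in_set_conv_nth)
      \<comment> \<open>The last entry of \<open>xs\<close> is the maximum of \<open>A\<close> and
        the first entry of \<open>ys\<close> the minimum of the complement, so they inherit
        \<open>b < a\<close>.\<close>
      have "a \<le> xs ! (d - 1)"
        using p xs(2,3) by (cases "p = d - 1") (auto simp: sorted_wrt_iff_nth_less less_imp_le)
      moreover have "ys ! 0 \<le> b"
        using q ys(2,3) by (cases "q = 0") (auto simp: sorted_wrt_iff_nth_less less_imp_le)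
      ultimately show ?thesis using ab(4) x[of d] y[of "d + 1"] d by simp
    qed
    ultimately show ?thesis
      using d unfolding descents_def by (auto, metis less_asym linorder_neqE_nat)
  qed
  then have "\<pi> \<in> perms_with_descents 1 m" using perm by (simp add: perms_with_descents_def)
  moreover have "initial_values m \<pi> = A"
    using img[of d] d xs by (simp add: initial_values_def descent_pos_def desc)
  ultimately show ?thesis by blast
qed

text \<open>\<open>initial_values\<close> is a bijection onto the non-initial sets and turns
  \<open>k\<close> gaps into \<open>k + 1\<close> intervals.\<close>

lemma card_one_descent_initial_gaps:
  "int (card {\<pi> \<in> perms_with_descents 1 m. initial_gaps m \<pi> = k}) =
     int (Suc m choose (2 * Suc k)) - (if k = 0 then int m else 0)"
proof -
  let ?S = "{\<pi> \<in> perms_with_descents 1 m. initial_gaps m \<pi> = k}"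
  have "initial_values m ` ?S = {A. non_initial m A \<and> card (block_ends A) = Suc k}"
  proof (intro equalityI subsetI)
    fix A assume "A \<in> initial_values m ` ?S"
    then obtain \<pi> where "\<pi> \<in> ?S" "A = initial_values m \<pi>" by (rule imageE)
    then show "A \<in> {A. non_initial m A \<and> card (block_ends A) = Suc k}"
      using initial_values_non_initial card_block_ends_initial_values by simp
  next
    fix A assume A: "A \<in> {A. non_initial m A \<and> card (block_ends A) = Suc k}"
    then obtain \<pi> where p: "\<pi> \<in> perms_with_descents 1 m" "initial_values m \<pi> = A"
      using grassmannian_permutation by blast
    then have "\<pi> \<in> ?S" using A card_block_ends_initial_values[OF p(1)] by simp
    with p(2) show "A \<in> initial_values m ` ?S" by blast
  qed
  moreover have "inj_on (initial_values m) ?S"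
    using inj_on_initial_values by (rule inj_on_subset) auto
  then have "card (initial_values m ` ?S) = card ?S" by (rule card_image)
  ultimately have "card ?S = card {A. non_initial m A \<and> card (block_ends A) = Suc k}" by (simp only:)
  then show ?thesis by (simp only: card_non_initial)
qed

theorem theorem6p7:
  fixes P :: "(real ^ 'n::finite) set" and n :: nat
  assumes "n = CARD('n)" and "n \<ge> 4"
    and "P = matroid_polytope (uniform_matroid_bases 2)"
  shows "h_star P 0 + h_star P 1 =
           int (card {\<pi> \<in> perms_with_descents 1 (n - 1). initial_gaps (n - 1) \<pi> = 0}) \<and>
         (\<forall>k\<ge>2. h_star P k =
           int (card {\<pi> \<in> perms_with_descents 1 (n - 1). initial_gaps (n - 1) \<pi> = k - 1}))"
proof -
  obtain m where m: "n = Suc m" "m > 0" using assms(2) by (cases n) auto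
  have h: "h_star P k = int (Suc m choose (2 * k)) - (if k = 1 then int (Suc m) else 0)" for k
  proof -
    have "ehrhart_series P =
        Abs_fps (\<lambda>t. int ((2 * t + m) choose m) - int (Suc m) * int ((t + m - 1) choose m))"
      using assms m card_bounded_nat_functions_sum[where 'a = 'n, of m]
      by (simp add: ehrhart_series_def lattice_point_count_uniform_2 del: of_nat_Suc)
    \<comment> \<open>The dimension is \<open>m\<close>, so the exponent in \<open>h_star\<close> is
      the one in the numerator computation.\<close>
    moreover have "nat (aff_dim P) + 1 = Suc m"
      using assms m aff_dim_uniform_2_polytope[where 'n = 'n] by simp
    ultimately show ?thesis
      unfolding h_star_def using uniform_2_ehrhart_numerator[OF m(2)] by (simp only:)
  qed
  have n: "n - 1 = m" using m by simp
  show ?thesis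
    unfolding n card_one_descent_initial_gaps h
  proof (intro conjI allI impI)
    \<comment> \<open>The corrections \<open>m + 1\<close> on the left and \<open>m\<close> on the
      right differ by one, which is exactly the entry of index 0.\<close>
    show "int (Suc m choose (2 * 0)) - (if (0::nat) = 1 then int (Suc m) else 0) +
        (int (Suc m choose (2 * 1)) - (if (1::nat) = 1 then int (Suc m) else 0)) =
        int (Suc m choose (2 * Suc 0)) - (if (0::nat) = 0 then int m else 0)"
      by (simp del: binomial_Suc_Suc)
    \<comment> \<open>Both corrections vanish from here on, and the binomials agree.\<close>
    fix k :: nat assume "2 \<le> k"
    then show "int (Suc m choose (2 * k)) - (if k = 1 then int (Suc m) else 0) =
        int (Suc m choose (2 * Suc (k - 1))) - (if k - 1 = 0 then int m else 0)"
      by (cases k) simp_all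
  qed
qed

end
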